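(* Let $\mathbb{S},\mathbb{U}$ be finite sets, let $\beta\in(0,1)$, and let $\{S_t\}_{t\ge 0}$, $\{U_t\}_{t\ge 0}$, $\{C_t\}_{t\ge 0}$ be stochastic processes on a common probability space taking values in $\mathbb{S}$, $\mathbb{U}$, $\mathbb{R}$ respectively (no Markov or stationarity property is assumed). Given an initial function $Q_0:\mathbb{S}\times\mathbb{U}\to\mathbb{R}$, define for all $t\ge 0$ and $(s,u)\in\mathbb{S}\times\mathbb{U}$ $$Q_{t+1}(s,u)=(1-\alpha_t(s,u))\,Q_t(s,u)+\alpha_t(s,u)\bigl(C_t+\beta V_t(S_{t+1})\bigr),\qquad V_t(s):=\min_{u\in\mathbb{U}}Q_t(s,u).$$ Assume: (i) $\alpha_t(s,u)=0$ unless $(S_t,U_t)=(s,u)$, and when $(S_t,U_t)=(s,u)$, $$\alpha_t(s,u)=\frac{1}{1+\sum_{k=0}^t 1_{\{S_k=s,U_k=u\}}};$$ moreover, with probability $1$, $\sum_t\alpha_t(s,u)=\infty$ for every $(s,u)$. (ii) There is a function $C^*:\mathbb{S}\times\mathbb{U}\to\mathbb{R}$ such that for every $(s,u)$, almost surely as $t\to\infty$, $$\frac{\sum_{k=0}^t C_k 1_{\{S_k=s,U_k=u\}}}{\sum_{k=0}^t 1_{\{S_k=s,U_k=u\}}}\to C^*(s,u).$$ (iii) There is a conditional probability (stochastic kernel) $P^*(\cdot|s,u)$ on $\mathbb{S}$ given $\mathbb{S}\times\mathbb{U}$ such that for every $f:\mathbb{S}\to\mathbb{R}$ and every $(s,u)$,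 almost surely as $t\to\infty$, $$\frac{\sum_{k=0}^t f(S_{k+1}) 1_{\{S_k=s,U_k=u\}}}{\sum_{k=0}^t 1_{\{S_k=s,U_k=u\}}}\to \sum_{s_1\in\mathbb{S}} f(s_1)P^*(s_1|s,u).$$ Then, for any initialization $Q_0$, $Q_t(s,u)\to Q^*(s,u)$ almost surely for each $(s,u)\in\mathbb{S}\times\mathbb{U}$, where $Q^*$ satisfies $$Q^*(s,u)=C^*(s,u)+\beta\sum_{s_1\in\mathbb{S}}V^*(s_1)P^*(s_1|s,u),\qquad V^*(s):=\min_{u\in\mathbb{U}}Q^*(s,u),$$ for all $(s,u)\in\mathbb{S}\times\mathbb{U}$.
   Context: $1_{\{\cdot\}}$ denotes the indicator function. The ratios in (ii) and (iii) are considered for $t$ large enough that the denominator is nonzero. *)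

theory Defs
  imports "HOL-Probability.Probability"
begin

definition state_value :: "('s \<Rightarrow> 'u::finite \<Rightarrow> real) \<Rightarrow> 's \<Rightarrow> real" where
  "state_value q s = (MIN u. q s u)"

primrec Q_iterate ::
  "real \<Rightarrow> (nat \<Rightarrow> 'w \<Rightarrow> 's \<Rightarrow> 'u::finite \<Rightarrow> real) \<Rightarrow> (nat \<Rightarrow> 'w \<Rightarrow> real) \<Rightarrow> (nat \<Rightarrow> 'w \<Rightarrow> 's)
    \<Rightarrow> ('s \<Rightarrow> 'u \<Rightarrow> real) \<Rightarrow> nat \<Rightarrow> 'w \<Rightarrow> 's \<Rightarrow> 'u \<Rightarrow> real" where
  "Q_iterate \<beta> \<alpha> C S Q0 0 = (\<lambda>\<omega>. Q0)"
| "Q_iterate \<beta> \<alpha> C S Q0 (Suc t) = (\<lambda>\<omega> s u.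
     (1 - \<alpha> t \<omega> s u) * Q_iterate \<beta> \<alpha> C S Q0 t \<omega> s u
     + \<alpha> t \<omega> s u * (C t \<omega> + \<beta> * state_value (Q_iterate \<beta> \<alpha> C S Q0 t \<omega>) (S (Suc t) \<omega>)))"

definition visit ::
  "(nat \<Rightarrow> 'w \<Rightarrow> 's) \<Rightarrow> (nat \<Rightarrow> 'w \<Rightarrow> 'u) \<Rightarrow> 's \<Rightarrow> 'u \<Rightarrow> nat \<Rightarrow> 'w \<Rightarrow> real" where
  "visit S U s u k \<omega> = of_bool (S k \<omega> = s \<and> U k \<omega> = u)"

end

theory Submission imports Defs
begin

text \<open>
  The argument is pathwise: the processes enter only through the almost sure limits, so one sample
  path on which all of them hold is fixed, and the rest is deterministic.

  The step size at the \<open>n\<close>-th visit to \<open>(s,u)\<close> is \<open>1/(n+1)\<close>, which makes the recursion a running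
  average: multiplying through by \<open>1 + n\<close> telescopes it, and \<open>Q\<^bsub>t+1\<^esub>(s,u)\<close> is the arithmetic mean of
  \<open>Q\<^sub>0(s,u)\<close> and the targets \<open>C\<^sub>k + \<beta> V\<^sub>k(S\<^bsub>k+1\<^esub>)\<close> collected at the visits
  (\<open>Q_iterate_eq_average\<close>). Let \<open>Q\<^sup>*\<close> be the fixed point of the discounted optimality equation, which
  exists because that equation is a \<open>\<beta>\<close>-contraction in the sup norm. Replacing \<open>V\<^sub>k\<close> by \<open>V\<^sup>*\<close> in the
  targets gives an average of observables that do not move with time, and the ergodic hypotheses say
  exactly that it tends to \<open>Q\<^sup>*(s,u)\<close>. What the replacement costs is at most \<open>\<beta>\<close> times the average,
  over the visits, of the earlier errors \<open>e\<^sub>k = max |Q\<^sub>k - Q\<^sup>*|\<close>, because the minimum over actions is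
  1-Lipschitz.

  Thus \<open>e\<close> satisfies \<open>e\<^bsub>t+1\<^esub> \<le> r\<^sub>t + \<beta> (average of e\<^sub>0, \<dots>, e\<^sub>t)\<close> with \<open>r\<^sub>t \<rightarrow> 0\<close>. Such a sequence is
  bounded, and since each pair is visited infinitely often, an average forgets any finite initial
  segment; so \<open>limsup e \<le> \<beta> limsup e\<close>, which forces \<open>e \<rightarrow> 0\<close> (\<open>averaged_contraction_tendsto_0\<close>).
\<close>

section \<open>The minimum over actions\<close>

lemma state_value_Lipschitz:
  fixes q r :: "'s \<Rightarrow> 'u::finite \<Rightarrow> real"
  assumes "\<And>u. \<bar>q s u - r s u\<bar> \<le> e"
  shows "\<bar>state_value q s - state_value r s\<bar> \<le> e"
proof -
  have one_sided: "state_value f s \<le> state_value g s + e"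
    if "\<And>u. \<bar>f s u - g s u\<bar> \<le> e" for f g :: "'s \<Rightarrow> 'u \<Rightarrow> real"
  proof -
    have "state_value g s \<in> range (g s)"
      unfolding state_value_def by (intro Min_in) auto
    then obtain u where u: "state_value g s = g s u" by auto
    have "state_value f s \<le> f s u"
      unfolding state_value_def by (intro Min_le) auto
    also have "\<dots> \<le> g s u + e" using that[of u] by linarith
    finally show ?thesis using u by simp
  qed
  have "\<bar>r s u - q s u\<bar> \<le> e" for u using assms[of u] by linarith
  from one_sided[of r q, OF this] one_sided[of q r, OF assms] show ?thesis by linarith
qed

lemma tendsto_state_value:
  fixes q :: "'s \<Rightarrow> 'u::finite \<Rightarrow> real"
  assumes "\<And>u. (\<lambda>n. x n s u) \<longlonglongrightarrow> q s u"
  shows "(\<lambda>n. state_value (x n) s) \<longlonglongrightarrow> state_value q s"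
proof (rule tendstoI)
  fix e :: real assume "0 < e"
  then have "\<forall>\<^sub>F n in sequentially. dist (x n s u) (q s u) < e / 2" for u
    using tendstoD[OF assms, of "e / 2"] by simp
  then have "\<forall>\<^sub>F n in sequentially. \<forall>u. dist (x n s u) (q s u) < e / 2"
    by (rule eventually_all_finite)
  then show "\<forall>\<^sub>F n in sequentially. dist (state_value (x n) s) (state_value q s) < e"
  proof eventually_elim
    case (elim n)
    then have "\<bar>state_value (x n) s - state_value q s\<bar> \<le> e / 2"
      by (intro state_value_Lipschitz) (simp add: dist_real_def less_imp_le)
    then show ?case using \<open>0 < e\<close> by (simp add: dist_real_def)
  qed
qed

section \<open>The discounted optimality equation\<close>

definition bellman ::
  "real \<Rightarrow> ('s \<Rightarrow> 'u \<Rightarrow> real) \<Rightarrow> ('s \<Rightarrow> 'u \<Rightarrow> 's pmf)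
    \<Rightarrow> ('s::finite \<Rightarrow> 'u::finite \<Rightarrow> real) \<Rightarrow> 's \<Rightarrow> 'u \<Rightarrow> real" where
  "bellman \<beta> c P q s u = c s u + \<beta> * (\<Sum>s1\<in>UNIV. state_value q s1 * pmf (P s u) s1)"

lemma bellman_contraction:
  fixes q r :: "'s::finite \<Rightarrow> 'u::finite \<Rightarrow> real"
  assumes "0 \<le> \<beta>" and "\<And>s u. \<bar>q s u - r s u\<bar> \<le> e"
  shows "\<bar>bellman \<beta> c P q s u - bellman \<beta> c P r s u\<bar> \<le> \<beta> * e"
proof -
  have "\<bar>(\<Sum>s1\<in>UNIV. state_value q s1 * pmf (P s u) s1)
          - (\<Sum>s1\<in>UNIV. state_value r s1 * pmf (P s u) s1)\<bar>
        = \<bar>\<Sum>s1\<in>UNIV. (state_value q s1 - state_value r s1) * pmf (P s u) s1\<bar>"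
    by (simp add: sum_subtractf left_diff_distrib)
  also have "\<dots> \<le> (\<Sum>s1\<in>UNIV. e * pmf (P s u) s1)"
    by (rule order_trans[OF sum_abs])
       (auto simp: abs_mult intro!: sum_mono mult_right_mono state_value_Lipschitz assms(2))
  also have "\<dots> = e"
    by (simp add: sum_distrib_left[symmetric] sum_pmf_eq_1)
  finally show ?thesis
    using assms(1) by (simp add: bellman_def right_diff_distrib[symmetric] abs_mult mult_left_mono)
qed

text \<open>
  Value iteration converges because consecutive iterates differ by at most a multiple of \<open>\<beta>\<^sup>n\<close>.
  Working with the iterates pointwise avoids having to equip the functions on pairs with the
  sup norm, for which the operator is a contraction.
\<close>
lemma bellman_fixed_point:
  fixes c :: "'s::finite \<Rightarrow> 'u::finite \<Rightarrow> real"
  assumes "0 \<le> \<beta>" "\<beta> < 1"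
  shows "\<exists>q. bellman \<beta> c P q = q"
proof -
  define x where "x n = (bellman \<beta> c P ^^ n) (\<lambda>_ _. 0)" for n
  have x_Suc: "x (Suc n) = bellman \<beta> c P (x n)" for n by (simp add: x_def)
  define K where "K = (\<Sum>(s, u)\<in>UNIV. \<bar>x 1 s u - x 0 s u\<bar>)"
  have step: "\<bar>x (Suc n) s u - x n s u\<bar> \<le> \<beta> ^ n * K" for n s u
  proof (induction n arbitrary: s u)
    case 0
    show ?case
      using member_le_sum[of "(s, u)" UNIV "\<lambda>(s, u). \<bar>x 1 s u - x 0 s u\<bar>"] by (auto simp: K_def)
  next
    case (Suc n)
    show ?case
      using bellman_contraction[OF assms(1) Suc.IH, where c = c and P = P and s = s and u = u] by (simp add: x_Suc mult.assoc)
  qed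
  have "convergent (\<lambda>n. x n s u)" for s u
  proof -
    have "summable (\<lambda>n. \<beta> ^ n * K)"
      using assms by (intro summable_mult2 summable_geometric) simp
    then have "summable (\<lambda>n. x (Suc n) s u - x n s u)"
      by (rule summable_comparison_test') (simp add: step)
    then have "convergent (\<lambda>n. x n s u - x 0 s u)"
      unfolding summable_iff_convergent sum_lessThan_telescope[of "\<lambda>n. x n s u"] .
    then show ?thesis
      using convergent_add[OF _ convergent_const[of "x 0 s u"], of "\<lambda>n. x n s u - x 0 s u"] by simp
  qed
  then obtain q where q: "(\<lambda>n. x n s u) \<longlonglongrightarrow> q s u" for s u
    unfolding convergent_def by metis
  have "(\<lambda>n. x (Suc n) s u) \<longlonglongrightarrow> bellman \<beta> c P q s u" for s u
    unfolding x_Suc bellman_def by (intro tendsto_intros tendsto_state_value q)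
  then have "bellman \<beta> c P q s u = q s u" for s u
    using LIMSEQ_unique LIMSEQ_Suc[OF q] by blast
  then show ?thesis by blast
qed

section \<open>Sequences dominated by a contracted average of their past\<close>

text \<open>
  The index \<open>i\<close> stands for the pair at which the error is largest, which may change with time; each
  pair averages the past over its own visits, with visit indicators as the weights \<open>w\<close>.

  Boundedness comes first: a bound \<open>B\<close> on the past propagates as soon as \<open>K + \<beta> B \<le> B\<close>, where \<open>K\<close>
  bounds \<open>r\<close>. Then any eventual bound \<open>D\<close> improves to \<open>\<beta> D + \<epsilon>\<close>, because the weight of the times
  before \<open>D\<close> became valid vanishes in the average. Taking \<open>\<epsilon> = (1 - \<beta>) D / 2\<close> turns this into a
  geometric decrease with ratio \<open>(1 + \<beta>) / 2\<close>.
\<close>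
lemma averaged_contraction_tendsto_0:
  fixes e :: "nat \<Rightarrow> real" and r w :: "'i::finite \<Rightarrow> nat \<Rightarrow> real"
  assumes "0 \<le> \<beta>" "\<beta> < 1"
    and e_nonneg: "\<And>t. 0 \<le> e t" and w_nonneg: "\<And>i k. 0 \<le> w i k"
    and weight_at_top: "\<And>i. filterlim (\<lambda>t. \<Sum>k=0..t. w i k) at_top sequentially"
    and r: "\<And>i. r i \<longlonglongrightarrow> 0"
    and rec: "\<And>t. \<exists>i. e (Suc t) \<le> r i t + \<beta> * ((\<Sum>k=0..t. w i k * e k) / (1 + (\<Sum>k=0..t. w i k)))"
  shows "e \<longlonglongrightarrow> 0"
proof -
  define N where "N i t = (\<Sum>k=0..t. w i k)" for i t
  have N_nonneg: "0 \<le> N i t" for i t unfolding N_def by (intro sum_nonneg w_nonneg)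
  have N_at_top: "filterlim (\<lambda>t. 1 + N i t) at_top sequentially" for i
    unfolding N_def
    by (rule filterlim_tendsto_add_at_top[OF tendsto_const weight_at_top])
  obtain K where K: "\<And>i t. r i t \<le> K"
  proof -
    have "\<exists>K. \<forall>t. r i t \<le> K" for i
      using convergent_imp_Bseq[OF convergentI[OF r[of i]]]
      unfolding Bseq_def real_norm_def by (meson abs_le_D1)
    then obtain k where k: "\<And>i t. r i t \<le> k i" by metis
    show ?thesis by (rule that[of "Max (range k)"]) (meson Max_ge finite finite_imageI k order_trans rangeI)
  qed
  define B where "B = max 1 (max (e 0) (K / (1 - \<beta>)))"
  have "0 < B" by (simp add: B_def)
  have "K / (1 - \<beta>) \<le> B" by (simp add: B_def)
  then have "K \<le> B * (1 - \<beta>)"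
    using assms(2) by (simp only: pos_divide_le_eq diff_gt_0_iff_gt)
  then have KB: "K + \<beta> * B \<le> B" by (simp add: algebra_simps)
  have e_le_B: "e t \<le> B" for t
  proof (induction t rule: less_induct)
    case (less t)
    show ?case
    proof (cases t)
      case 0
      then show ?thesis by (simp add: B_def)
    next
      case (Suc m)
      from rec[of m] obtain i where
        i: "e (Suc m) \<le> r i m + \<beta> * ((\<Sum>k=0..m. w i k * e k) / (1 + N i m))"
        unfolding N_def by blast
      have "(\<Sum>k=0..m. w i k * e k) \<le> (\<Sum>k=0..m. w i k * B)"
        using less Suc by (intro sum_mono mult_left_mono w_nonneg) auto
      also have "\<dots> \<le> B * (1 + N i m)"
        using \<open>0 < B\<close> unfolding sum_distrib_right[symmetric] N_def[symmetric]
        by (simp add: algebra_simps)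
      finally have "(\<Sum>k=0..m. w i k * e k) / (1 + N i m) \<le> B"
        using N_nonneg[of i m] by (simp add: pos_divide_le_eq)
      from mult_left_mono[OF this assms(1)] show ?thesis
        using i K[of i m] KB unfolding Suc by linarith
    qed
  qed
  have improve: "\<forall>\<^sub>F t in sequentially. e t \<le> (1 + \<beta>) / 2 * D"
    if "0 < D" and "\<forall>\<^sub>F t in sequentially. e t \<le> D" for D
  proof -
    obtain T where T: "\<And>t. T \<le> t \<Longrightarrow> e t \<le> D"
      using \<open>\<forall>\<^sub>F t in sequentially. e t \<le> D\<close> unfolding eventually_sequentially by blast
    define c where "c i = (\<Sum>k<T. w i k * B)" for i
    have split: "(\<Sum>k=0..t. w i k * e k) \<le> c i + D * N i t" for i t
    proof -
      have "w i k * e k \<le> (if k < T then w i k * B else 0) + D * w i k" for k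
        using mult_left_mono[OF T[of k] w_nonneg[of i k]]
          mult_left_mono[OF e_le_B[of k] w_nonneg[of i k]]
          mult_nonneg_nonneg[OF less_imp_le[OF \<open>0 < D\<close>] w_nonneg[of i k]]
        by (simp add: mult.commute[of D])
      then have "(\<Sum>k=0..t. w i k * e k) \<le> (\<Sum>k=0..t. (if k < T then w i k * B else 0) + D * w i k)"
        by (intro sum_mono)
      also have "\<dots> = (\<Sum>k\<in>{0..t} \<inter> {..<T}. w i k * B) + D * N i t"
        by (simp add: sum.distrib N_def sum_distrib_left sum.inter_restrict)
      also have "(\<Sum>k\<in>{0..t} \<inter> {..<T}. w i k * B) \<le> c i"
        unfolding c_def using \<open>0 < B\<close> by (intro sum_mono2) (auto intro: mult_nonneg_nonneg w_nonneg)
      finally show ?thesis by simp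
    qed
    have "(\<lambda>t. r i t + \<beta> * (c i / (1 + N i t))) \<longlonglongrightarrow> 0 + \<beta> * 0" for i
      by (intro tendsto_add r tendsto_mult_left real_tendsto_divide_at_top[OF tendsto_const N_at_top])
    then have "\<forall>\<^sub>F t in sequentially. r i t + \<beta> * (c i / (1 + N i t)) < (1 - \<beta>) / 2 * D" for i
      using \<open>0 < D\<close> assms(2) by (intro order_tendstoD(2)[of _ 0]) auto
    then have "\<forall>\<^sub>F t in sequentially. \<forall>i. r i t + \<beta> * (c i / (1 + N i t)) < (1 - \<beta>) / 2 * D"
      by (rule eventually_all_finite)
    then have "\<forall>\<^sub>F t in sequentially. e (Suc t) \<le> (1 + \<beta>) / 2 * D"
    proof eventually_elim
      case (elim t)
      from rec[of t] obtain i where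
        i: "e (Suc t) \<le> r i t + \<beta> * ((\<Sum>k=0..t. w i k * e k) / (1 + N i t))"
        unfolding N_def by blast
      have "(\<Sum>k=0..t. w i k * e k) / (1 + N i t) \<le> (c i + D * (1 + N i t)) / (1 + N i t)"
        using split[of i t] \<open>0 < D\<close> N_nonneg[of i t]
        by (intro divide_right_mono) (auto simp: algebra_simps)
      also have "\<dots> = c i / (1 + N i t) + D"
        using N_nonneg[of i t] by (simp add: add_divide_distrib)
      finally have "\<beta> * ((\<Sum>k=0..t. w i k * e k) / (1 + N i t)) \<le> \<beta> * (c i / (1 + N i t)) + \<beta> * D"
        using mult_left_mono[OF _ assms(1)] by (metis distrib_left)
      with i elim[rule_format, of i]
      have "e (Suc t) \<le> (1 - \<beta>) / 2 * D + \<beta> * D" by linarith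
      then show ?case by (simp add: field_simps)
    qed
    then show ?thesis by (rule eventually_sequentially_Suc[THEN iffD1])
  qed
  define \<gamma> where "\<gamma> = (1 + \<beta>) / 2"
  have \<gamma>: "0 < \<gamma>" "\<gamma> < 1" using assms(1,2) by (auto simp: \<gamma>_def)
  have geometric: "\<forall>\<^sub>F t in sequentially. e t \<le> \<gamma> ^ n * B" for n
  proof (induction n)
    case 0
    show ?case using e_le_B by simp
  next
    case (Suc n)
    then show ?case
      using improve[of "\<gamma> ^ n * B"] \<gamma> \<open>0 < B\<close> by (simp add: \<gamma>_def[symmetric] mult.assoc)
  qed
  have "(\<lambda>n. \<gamma> ^ n * B) \<longlonglongrightarrow> 0 * B"
    using \<gamma> by (intro tendsto_mult_right LIMSEQ_realpow_zero) auto
  then have small: "\<forall>\<^sub>F n in sequentially. \<gamma> ^ n * B < d" if "0 < d" for d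
    using that by (intro order_tendstoD(2)[of _ 0]) auto
  show ?thesis
  proof (rule tendstoI)
    fix d :: real assume "0 < d"
    obtain n where n: "\<gamma> ^ n * B < d"
      using eventually_happens[OF small[OF \<open>0 < d\<close>]] by auto
    show "\<forall>\<^sub>F t in sequentially. dist (e t) 0 < d"
      using geometric[of n] by eventually_elim (use n e_nonneg in \<open>auto simp: dist_real_def\<close>)
  qed
qed

section \<open>The recursion along one sample path\<close>

lemma visit_nonneg: "0 \<le> visit S U s u k \<omega>"
  by (simp add: visit_def)

text \<open>
  With the counter \<open>1 + N\<close> starting at 1, the initial function plays the part of one extra sample.
\<close>
lemma Q_iterate_eq_average:
  fixes C :: "nat \<Rightarrow> 'w \<Rightarrow> real"
  assumes alpha: "\<And>t. \<alpha> t \<omega> s u = visit S U s u t \<omega> / (1 + (\<Sum>k=0..t. visit S U s u k \<omega>))"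
  shows "Q_iterate \<beta> \<alpha> C S Q0 (Suc t) \<omega> s u =
    (Q0 s u + (\<Sum>k=0..t. visit S U s u k \<omega> *
        (C k \<omega> + \<beta> * state_value (Q_iterate \<beta> \<alpha> C S Q0 k \<omega>) (S (Suc k) \<omega>))))
      / (1 + (\<Sum>k=0..t. visit S U s u k \<omega>))"
proof -
  define Q where "Q t = Q_iterate \<beta> \<alpha> C S Q0 t \<omega>" for t
  define y where "y k = C k \<omega> + \<beta> * state_value (Q k) (S (Suc k) \<omega>)" for k
  define v where "v k = visit S U s u k \<omega>" for k
  have Q_Suc: "Q (Suc t) s u = (1 - \<alpha> t \<omega> s u) * Q t s u + \<alpha> t \<omega> s u * y t" for t
    by (simp add: Q_def y_def)
  have N: "0 < 1 + (\<Sum>k=0..t. v k)" for t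
    unfolding v_def by (intro add_pos_nonneg sum_nonneg visit_nonneg) simp
  have step: "(1 + (\<Sum>k=0..t. v k)) * Q (Suc t) s u
      = (1 + (\<Sum>k=0..t. v k) - v t) * Q t s u + v t * y t" for t
  proof -
    have weight: "(1 + (\<Sum>k=0..t. v k)) * \<alpha> t \<omega> s u = v t"
      using N[of t] unfolding alpha v_def[symmetric] by simp
    have "(1 + (\<Sum>k=0..t. v k)) * Q (Suc t) s u
        = (1 + (\<Sum>k=0..t. v k) - (1 + (\<Sum>k=0..t. v k)) * \<alpha> t \<omega> s u) * Q t s u
          + (1 + (\<Sum>k=0..t. v k)) * \<alpha> t \<omega> s u * y t"
      unfolding Q_Suc by (simp add: algebra_simps)
    then show ?thesis unfolding weight .
  qed
  have "(1 + (\<Sum>k=0..t. v k)) * Q (Suc t) s u = Q0 s u + (\<Sum>k=0..t. v k * y k)"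
  proof (induction t)
    case 0
    show ?case using step[of 0] by (simp add: Q_def)
  next
    case (Suc t)
    then show ?case using step[of "Suc t"] by simp
  qed
  then have "Q (Suc t) s u = (Q0 s u + (\<Sum>k=0..t. v k * y k)) / (1 + (\<Sum>k=0..t. v k))"
    using N[of t] by (simp add: field_simps)
  then show ?thesis unfolding Q_def v_def y_def .
qed

text \<open>
  With \<open>V\<^sup>* = state_value q\<close>, the targets split at \<open>V\<^sub>k = V\<^sup>* + (V\<^sub>k - V\<^sup>*)\<close>: the first part
  averages a fixed observable and converges to \<open>q s u\<close>, the initial value washing out, and the
  second is at most \<open>\<beta>\<close> times the averaged error. The convergence is stated for a \<open>q\<close> that is the
  limit of the averages it generates; for the fixed point of the optimality equation this is what
  the ergodic hypotheses provide.
\<close>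
lemma Q_iterate_tendsto_fixed_point:
  fixes S :: "nat \<Rightarrow> 'w \<Rightarrow> 's::finite" and U :: "nat \<Rightarrow> 'w \<Rightarrow> 'u::finite"
    and C :: "nat \<Rightarrow> 'w \<Rightarrow> real" and q :: "'s \<Rightarrow> 'u \<Rightarrow> real"
  assumes "0 \<le> \<beta>" "\<beta> < 1"
    and alpha: "\<And>t s u. \<alpha> t \<omega> s u = visit S U s u t \<omega> / (1 + (\<Sum>k=0..t. visit S U s u k \<omega>))"
    and visits: "\<And>s u. filterlim (\<lambda>t. \<Sum>k=0..t. visit S U s u k \<omega>) at_top sequentially"
    and average: "\<And>s u. (\<lambda>t. (\<Sum>k=0..t. visit S U s u k \<omega> * (C k \<omega> + \<beta> * state_value q (S (Suc k) \<omega>)))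
          / (\<Sum>k=0..t. visit S U s u k \<omega>)) \<longlonglongrightarrow> q s u"
  shows "(\<lambda>t. Q_iterate \<beta> \<alpha> C S Q0 t \<omega> s u) \<longlonglongrightarrow> q s u"
proof -
  define Q where "Q t = Q_iterate \<beta> \<alpha> C S Q0 t \<omega>" for t
  define v where "v i k = visit S U (fst i) (snd i) k \<omega>" for i k
  define N where "N i t = (\<Sum>k=0..t. v i k)" for i t
  define y where "y k = C k \<omega> + \<beta> * state_value q (S (Suc k) \<omega>)" for k
  define d where "d k = state_value (Q k) (S (Suc k) \<omega>) - state_value q (S (Suc k) \<omega>)" for k
  define e where "e t = (MAX (s, u). \<bar>Q t s u - q s u\<bar>)" for t
  have le_e: "\<bar>Q t s u - q s u\<bar> \<le> e t" for t s u
    unfolding e_def by (rule Max_ge) (auto intro!: image_eqI[of _ _ "(s, u)"])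
  have e_nonneg: "0 \<le> e t" for t
    using le_e[of t undefined undefined] by linarith
  have v_nonneg: "0 \<le> v i k" for i k unfolding v_def by (rule visit_nonneg)
  have N_nonneg: "0 \<le> N i t" for i t unfolding N_def by (intro sum_nonneg v_nonneg)
  have N_at_top: "filterlim (N i) at_top sequentially" for i
    unfolding N_def v_def by (rule visits)
  have N1_at_top: "filterlim (\<lambda>t. 1 + N i t) at_top sequentially" for i
    by (rule filterlim_tendsto_add_at_top[OF tendsto_const N_at_top])
  have Q_Suc: "Q (Suc t) (fst i) (snd i) =
      (Q0 (fst i) (snd i) + (\<Sum>k=0..t. v i k * y k)) / (1 + N i t)
        + \<beta> * ((\<Sum>k=0..t. v i k * d k) / (1 + N i t))" for i t
  proof -
    have "v i k * (C k \<omega> + \<beta> * state_value (Q k) (S (Suc k) \<omega>)) = v i k * y k + \<beta> * (v i k * d k)" for k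
      by (simp add: y_def d_def algebra_simps)
    then show ?thesis
      unfolding Q_def Q_iterate_eq_average[of \<alpha> \<omega> "fst i" "snd i" S U, OF alpha]
      by (simp add: Q_def[symmetric] v_def[symmetric] N_def[symmetric] sum.distrib
          sum_distrib_left[symmetric] add_divide_distrib add.assoc)
  qed
  define r where
    "r i t = \<bar>(Q0 (fst i) (snd i) + (\<Sum>k=0..t. v i k * y k)) / (1 + N i t) - q (fst i) (snd i)\<bar>"
    for i t
  have r: "r i \<longlonglongrightarrow> 0" for i
  proof -
    define m where "m t = (\<Sum>k=0..t. v i k * y k) / N i t" for t
    have m: "m \<longlonglongrightarrow> q (fst i) (snd i)"
      using average[of "fst i" "snd i"] by (simp add: m_def[abs_def] v_def N_def y_def)
    have "(\<lambda>t. m t + (Q0 (fst i) (snd i) - m t) / (1 + N i t)) \<longlonglongrightarrow> q (fst i) (snd i) + 0"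
      by (intro tendsto_add m real_tendsto_divide_at_top[OF tendsto_diff[OF tendsto_const m] N1_at_top])
    moreover have "\<forall>\<^sub>F t in sequentially. 0 < N i t"
      using N_at_top[of i] unfolding filterlim_at_top_dense by blast
    then have "\<forall>\<^sub>F t in sequentially. m t + (Q0 (fst i) (snd i) - m t) / (1 + N i t)
        = (Q0 (fst i) (snd i) + (\<Sum>k=0..t. v i k * y k)) / (1 + N i t)"
    proof eventually_elim
      case (elim t)
      then have "(\<Sum>k=0..t. v i k * y k) = m t * N i t" by (simp add: m_def)
      then show ?case using elim by (simp add: field_simps)
    qed
    ultimately have "(\<lambda>t. (Q0 (fst i) (snd i) + (\<Sum>k=0..t. v i k * y k)) / (1 + N i t))
        \<longlonglongrightarrow> q (fst i) (snd i)"
      unfolding add_0_right by (rule Lim_transform_eventually)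
    then show ?thesis
      unfolding r_def by (intro tendsto_rabs_zero) (simp add: LIM_zero)
  qed
  have rec: "\<exists>i. e (Suc t) \<le> r i t + \<beta> * ((\<Sum>k=0..t. v i k * e k) / (1 + (\<Sum>k=0..t. v i k)))" for t
  proof -
    have "e (Suc t) \<in> range (\<lambda>(s, u). \<bar>Q (Suc t) s u - q s u\<bar>)"
      unfolding e_def by (intro Max_in) auto
    then obtain i where i: "e (Suc t) = \<bar>Q (Suc t) (fst i) (snd i) - q (fst i) (snd i)\<bar>"
      by auto
    have "\<bar>\<Sum>k=0..t. v i k * d k\<bar> \<le> (\<Sum>k=0..t. v i k * e k)"
      by (rule order_trans[OF sum_abs])
         (auto simp: abs_mult v_nonneg d_def
           intro!: sum_mono mult_left_mono state_value_Lipschitz le_e)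
    then have "\<bar>\<beta> * ((\<Sum>k=0..t. v i k * d k) / (1 + N i t))\<bar>
        \<le> \<beta> * ((\<Sum>k=0..t. v i k * e k) / (1 + N i t))"
      using assms(1) N_nonneg[of i t]
      by (auto simp: abs_mult intro!: mult_left_mono divide_right_mono)
    then show ?thesis
      unfolding i Q_Suc N_def[symmetric] r_def by (intro exI[of _ i]) linarith
  qed
  have "e \<longlonglongrightarrow> 0"
    using averaged_contraction_tendsto_0[OF assms(1,2) e_nonneg v_nonneg N_at_top[unfolded N_def] r rec] .
  then have "(\<lambda>t. Q t s u - q s u) \<longlonglongrightarrow> 0"
    by (rule Lim_null_comparison[rotated]) (simp add: le_e)
  then show ?thesis
    unfolding Q_def by (rule LIM_zero_cancel)
qed

theorem theorem2p1:
  fixes M :: "'w measure"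
    and \<beta> :: real
    and S :: "nat \<Rightarrow> 'w \<Rightarrow> 's::finite"
    and U :: "nat \<Rightarrow> 'w \<Rightarrow> 'u::finite"
    and C :: "nat \<Rightarrow> 'w \<Rightarrow> real"
    and \<alpha> :: "nat \<Rightarrow> 'w \<Rightarrow> 's \<Rightarrow> 'u \<Rightarrow> real"
    and Cstar :: "'s \<Rightarrow> 'u \<Rightarrow> real"
    and Pstar :: "'s \<Rightarrow> 'u \<Rightarrow> 's pmf"
  assumes "prob_space M"
    and "0 < \<beta>" and "\<beta> < 1"
    and "\<And>t. S t \<in> measurable M (count_space UNIV)"
    and "\<And>t. U t \<in> measurable M (count_space UNIV)"
    and "\<And>t. C t \<in> borel_measurable M"
    and alpha_zero: "\<And>t \<omega> s u. \<omega> \<in> space M \<Longrightarrow> (S t \<omega>, U t \<omega>) \<noteq> (s, u) \<Longrightarrow> \<alpha> t \<omega> s u = 0"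
    and alpha_visit: "\<And>t \<omega> s u. \<omega> \<in> space M \<Longrightarrow> (S t \<omega>, U t \<omega>) = (s, u) \<Longrightarrow>
          \<alpha> t \<omega> s u = 1 / (1 + (\<Sum>k=0..t. visit S U s u k \<omega>))"
    and alpha_sum: "AE \<omega> in M. \<forall>s u.
          filterlim (\<lambda>n. \<Sum>t=0..n. \<alpha> t \<omega> s u) at_top sequentially"
    and cost_average: "\<And>s u. AE \<omega> in M.
          (\<lambda>t. (\<Sum>k=0..t. C k \<omega> * visit S U s u k \<omega>) / (\<Sum>k=0..t. visit S U s u k \<omega>))
            \<longlonglongrightarrow> Cstar s u"
    and transition_average: "\<And>(f :: 's \<Rightarrow> real) s u. AE \<omega> in M.
          (\<lambda>t. (\<Sum>k=0..t. f (S (Suc k) \<omega>) * visit S U s u k \<omega>) / (\<Sum>k=0..t. visit S U s u k \<omega>))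
            \<longlonglongrightarrow> (\<Sum>s1\<in>UNIV. f s1 * pmf (Pstar s u) s1)"
  shows "\<exists>Qstar :: 's \<Rightarrow> 'u \<Rightarrow> real.
      (\<forall>s u. Qstar s u =
         Cstar s u + \<beta> * (\<Sum>s1\<in>UNIV. state_value Qstar s1 * pmf (Pstar s u) s1)) \<and>
      (\<forall>Q0 s u. AE \<omega> in M. (\<lambda>t. Q_iterate \<beta> \<alpha> C S Q0 t \<omega> s u) \<longlonglongrightarrow> Qstar s u)"
proof -
  obtain q where "bellman \<beta> Cstar Pstar q = q"
    using bellman_fixed_point[of \<beta> Cstar Pstar] assms(2,3) by auto
  then have "q s u = bellman \<beta> Cstar Pstar q s u" for s u by simp
  then have q: "q s u = Cstar s u + \<beta> * (\<Sum>s1\<in>UNIV. state_value q s1 * pmf (Pstar s u) s1)" for s u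
    unfolding bellman_def .
  have alpha: "\<alpha> t \<omega> s u = visit S U s u t \<omega> / (1 + (\<Sum>k=0..t. visit S U s u k \<omega>))"
    if "\<omega> \<in> space M" for t \<omega> s u
  proof (cases "(S t \<omega>, U t \<omega>) = (s, u)")
    case True
    then show ?thesis using alpha_visit[OF that True] by (simp add: visit_def[of S U s u t \<omega>])
  next
    case False
    then show ?thesis using alpha_zero[OF that False] by (simp add: visit_def[of S U s u t \<omega>])
  qed
  have cost: "AE \<omega> in M. \<forall>s u.
      (\<lambda>t. (\<Sum>k=0..t. C k \<omega> * visit S U s u k \<omega>) / (\<Sum>k=0..t. visit S U s u k \<omega>))
        \<longlonglongrightarrow> Cstar s u"
    using cost_average by (simp add: AE_all_countable)
  have transition: "AE \<omega> in M. \<forall>s u.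
      (\<lambda>t. (\<Sum>k=0..t. state_value q (S (Suc k) \<omega>) * visit S U s u k \<omega>)
            / (\<Sum>k=0..t. visit S U s u k \<omega>))
        \<longlonglongrightarrow> (\<Sum>s1\<in>UNIV. state_value q s1 * pmf (Pstar s u) s1)"
    using transition_average by (simp add: AE_all_countable)
  have "AE \<omega> in M. (\<lambda>t. Q_iterate \<beta> \<alpha> C S Q0 t \<omega> s u) \<longlonglongrightarrow> q s u" for Q0 s u
    using alpha_sum cost transition AE_space
  proof eventually_elim
    case (elim \<omega>)
    note divergent = elim(1) and cost = elim(2) and transition = elim(3) and \<omega> = elim(4)
    show ?case
    proof (rule Q_iterate_tendsto_fixed_point[where U = U])
      show "0 \<le> \<beta>" "\<beta> < 1" using assms(2,3) by auto
      show "\<alpha> t \<omega> s u = visit S U s u t \<omega> / (1 + (\<Sum>k=0..t. visit S U s u k \<omega>))" for t s u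
        by (rule alpha[OF \<omega>])
      \<comment> \<open>A step size never exceeds its visit indicator, so divergent step sizes force
          infinitely many visits.\<close>
      show "filterlim (\<lambda>t. \<Sum>k=0..t. visit S U s u k \<omega>) at_top sequentially" for s u
      proof (rule filterlim_at_top_mono[OF divergent[rule_format, of s u]])
        have "\<alpha> t \<omega> s u \<le> visit S U s u t \<omega>" for t
        proof -
          have "0 \<le> (\<Sum>k=0..t. visit S U s u k \<omega>)" by (intro sum_nonneg visit_nonneg)
          then show ?thesis
            unfolding alpha[OF \<omega>]
            using visit_nonneg[of S U s u t \<omega>] by (simp add: pos_divide_le_eq distrib_left)
        qed
        then show "\<forall>\<^sub>F n in sequentially. (\<Sum>t=0..n. \<alpha> t \<omega> s u) \<le> (\<Sum>k=0..n. visit S U s u k \<omega>)"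
          by (intro always_eventually allI sum_mono)
      qed
      show "(\<lambda>t. (\<Sum>k=0..t. visit S U s u k \<omega> * (C k \<omega> + \<beta> * state_value q (S (Suc k) \<omega>)))
          / (\<Sum>k=0..t. visit S U s u k \<omega>)) \<longlonglongrightarrow> q s u" for s u
        using tendsto_add[OF cost[rule_format, of s u]
            tendsto_mult_left[OF transition[rule_format, of s u], of \<beta>]]
        unfolding q[of s u]
        by (simp add: distrib_left sum.distrib add_divide_distrib sum_distrib_left mult_ac)
    qed
  qed
  with q show ?thesis by blast
qed

end
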